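(* Let $\delta>0$ be a real number, let $P_\delta=[0,2\pi)\times[-\delta,\delta]$ be endowed with the Möbius strip topology (described in the context), and let $\mathbf{v}\colon P_\delta\to\mathbb{R}^3$ be given by $$\mathbf{v}(t,r)=\big(\cos t+r\cos\tfrac t2\,\cos t,\ \sin t+r\cos\tfrac t2\,\sin t,\ r\sin\tfrac t2\big).$$ Let the image $\mathbf{v}(P_\delta)$ carry the topology induced by the standard topology of $\mathbb{R}^3$. Then the map $P_\delta\ni(t,r)\mapsto\mathbf{v}(t,r)\in\mathbf{v}(P_\delta)$ is a homeomorphism if and only if $\delta<2$.
   Context: The Möbius strip (of width $2\delta$) is the set $P_\delta=[0,2\pi)\times[-\delta,\delta]$ with the topology generated by the base consisting of all sets $P_\delta\cap(B_{p,\varepsilon}\cup B_{\tilde p,\varepsilon})$, where $p=(t,r)\in P_\delta$, $\tilde p:=(t+2\pi,-r)$, $\varepsilon\in(0,\infty)$, and $B_{p,\varepsilon}$ is the open ball in $\mathbb{R}^2$ of radius $\varepsilon$ centered at $p$. Equivalently, it is the topology transported to $P_\delta$ from the quotient of the closed rectangle $[0,2\pi]\times[-\delta,\delta]$ (with its usual topology) by the identification of each point $(2\pi,r)$ with $(0,-r)$, each class being represented by its unique element in $P_\delta$. *)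

theory Defs
  imports "HOL-Analysis.Analysis"
begin

definition mobius_carrier :: "real \<Rightarrow> (real \<times> real) set" where
  "mobius_carrier \<delta> = {0..<2 * pi} \<times> {-\<delta>..\<delta>}"

definition mobius_twin :: "real \<times> real \<Rightarrow> real \<times> real" where
  "mobius_twin p = (fst p + 2 * pi, - snd p)"

definition mobius_nbhd :: "real \<Rightarrow> real \<times> real \<Rightarrow> real \<Rightarrow> (real \<times> real) set" where
  "mobius_nbhd \<delta> p \<epsilon> = mobius_carrier \<delta> \<inter> (ball p \<epsilon> \<union> ball (mobius_twin p) \<epsilon>)"

text \<open>\<open>topology_generated_by\<close> treats its argument as a subbase; the sets given here are in
  fact a base, see \<open>openin_mobius_topology_iff\<close> below.\<close>

definition mobius_topology :: "real \<Rightarrow> (real \<times> real) topology" where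
  "mobius_topology \<delta> =
     topology_generated_by {mobius_nbhd \<delta> p \<epsilon> |p \<epsilon>. p \<in> mobius_carrier \<delta> \<and> 0 < \<epsilon>}"

definition mobius_map :: "real \<times> real \<Rightarrow> real ^ 3" where
  "mobius_map = (\<lambda>(t, r). vector
     [cos t + r * cos (t / 2) * cos t,
      sin t + r * cos (t / 2) * sin t,
      r * sin (t / 2)])"

lemma mobius_nbhd_self: "p \<in> mobius_carrier \<delta> \<Longrightarrow> 0 < \<epsilon> \<Longrightarrow> p \<in> mobius_nbhd \<delta> p \<epsilon>"
  by (simp add: mobius_nbhd_def)

lemma mobius_nbhd_subset: "mobius_nbhd \<delta> p \<epsilon> \<subseteq> mobius_carrier \<delta>"
  by (auto simp: mobius_nbhd_def)

lemma topspace_mobius_topology: "topspace (mobius_topology \<delta>) = mobius_carrier \<delta>"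
proof
  show "topspace (mobius_topology \<delta>) \<subseteq> mobius_carrier \<delta>"
    unfolding mobius_topology_def topology_generated_by_topspace
    using mobius_nbhd_subset by (intro Union_least) blast
  show "mobius_carrier \<delta> \<subseteq> topspace (mobius_topology \<delta>)"
  proof
    fix p assume p: "p \<in> mobius_carrier \<delta>"
    show "p \<in> topspace (mobius_topology \<delta>)"
      unfolding mobius_topology_def topology_generated_by_topspace
      by (rule UnionI[OF _ mobius_nbhd_self[OF p zero_less_one]])
        (use p zero_less_one in blast)
  qed
qed

lemma ball_subset_ball_dist:
  fixes x y :: "'a::metric_space"
  assumes "dist x y \<le> c" "d \<le> e - c"
  shows "ball x d \<subseteq> ball y e"
proof
  fix z assume "z \<in> ball x d"
  then have "dist x z < d" by simp
  moreover have "dist y z \<le> dist x y + dist x z" by (metis dist_commute dist_triangle)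
  ultimately show "z \<in> ball y e" using assms by simp
qed

lemma mobius_nbhd_refine:
  assumes p: "p \<in> mobius_carrier \<delta>" and q: "q \<in> mobius_nbhd \<delta> p e"
  shows "\<exists>d>0. mobius_nbhd \<delta> q d \<subseteq> mobius_nbhd \<delta> p e"
proof (cases "q \<in> ball p e")
  case True
  have "dist (mobius_twin q) (mobius_twin p) = dist q p"
    by (simp add: mobius_twin_def dist_prod_def dist_real_def abs_minus_commute)
  then have "ball (mobius_twin q) (e - dist q p) \<subseteq> ball (mobius_twin p) e"
    by (intro ball_subset_ball_dist) auto
  moreover have "ball q (e - dist q p) \<subseteq> ball p e"
    by (intro ball_subset_ball_dist) auto
  ultimately have "mobius_nbhd \<delta> q (e - dist q p) \<subseteq> mobius_nbhd \<delta> p e"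
    unfolding mobius_nbhd_def by blast
  moreover have "0 < e - dist q p" using True by (simp add: dist_commute)
  ultimately show ?thesis by blast
next
  case False
  let ?c = "dist q (mobius_twin p)"
  have qc: "q \<in> mobius_carrier \<delta>" and c: "?c < e"
    using q False by (auto simp: mobius_nbhd_def dist_commute)
  obtain t r s u where [simp]: "p = (t, r)" "q = (s, u)" by fastforce
  have t: "0 \<le> t" "t < 2 * pi" and s: "0 \<le> s" "s < 2 * pi"
    using p qc by (auto simp: mobius_carrier_def)
  have near: "ball q (e - ?c) \<subseteq> ball (mobius_twin p) e"
    by (intro ball_subset_ball_dist) auto
  show ?thesis
  proof (cases "s = 0")
    case True
    have "\<bar>2 * pi - t\<bar> \<le> \<bar>t + 2 * pi\<bar>" using t by simp
    then have "(2 * pi - t)\<^sup>2 \<le> (t + 2 * pi)\<^sup>2" by (simp only: abs_le_square_iff)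
    moreover have "(0 - (t + 2 * pi))\<^sup>2 = (t + 2 * pi)\<^sup>2" "(u - - r)\<^sup>2 = (- u - r)\<^sup>2"
      by (simp_all add: power2_eq_square algebra_simps)
    ultimately have "dist (mobius_twin q) p \<le> ?c"
      using True by (simp add: mobius_twin_def dist_prod_def dist_real_def)
    then have "ball (mobius_twin q) (e - ?c) \<subseteq> ball p e"
      by (intro ball_subset_ball_dist) auto
    with near have "mobius_nbhd \<delta> q (e - ?c) \<subseteq> mobius_nbhd \<delta> p e"
      unfolding mobius_nbhd_def by blast
    with c show ?thesis by (meson diff_gt_0_iff_gt)
  next
    case False
    define d where "d = min (e - ?c) s"
    have d: "0 < d" using c s False by (simp add: d_def)
    have "\<not> dist (mobius_twin q) z < d" if "z \<in> mobius_carrier \<delta>" for z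
    proof -
      have "s \<le> dist (fst (mobius_twin q)) (fst z)"
        using that by (auto simp: mobius_carrier_def mobius_twin_def dist_real_def)
      also have "\<dots> \<le> dist (mobius_twin q) z" by (rule dist_fst_le)
      finally show ?thesis by (simp add: d_def)
    qed
    moreover have "ball q d \<subseteq> ball (mobius_twin p) e"
      using near by (auto simp: d_def)
    ultimately have "mobius_nbhd \<delta> q d \<subseteq> mobius_nbhd \<delta> p e"
      unfolding mobius_nbhd_def by auto
    with d show ?thesis by blast
  qed
qed

lemma mobius_nbhd_mono: "d \<le> e \<Longrightarrow> mobius_nbhd \<delta> p d \<subseteq> mobius_nbhd \<delta> p e"
  by (auto simp: mobius_nbhd_def)

lemma openin_mobius_topology_iff:
  "openin (mobius_topology \<delta>) U \<longleftrightarrow>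
     U \<subseteq> mobius_carrier \<delta> \<and> (\<forall>p\<in>U. \<exists>\<epsilon>>0. mobius_nbhd \<delta> p \<epsilon> \<subseteq> U)" (is "_ \<longleftrightarrow> ?R U")
proof
  let ?B = "{mobius_nbhd \<delta> p \<epsilon> |p \<epsilon>. p \<in> mobius_carrier \<delta> \<and> 0 < \<epsilon>}"
  assume "openin (mobius_topology \<delta>) U"
  then have "generate_topology_on ?B U"
    by (simp add: mobius_topology_def openin_topology_generated_by_iff)
  then show "?R U"
  proof induction
    case Empty
    show ?case by simp
  next
    case (Int A B)
    show ?case
    proof (intro conjI ballI)
      show "A \<inter> B \<subseteq> mobius_carrier \<delta>" using Int.IH(1) by blast
    next
      fix p assume p: "p \<in> A \<inter> B"
      obtain d where d: "d > 0" "mobius_nbhd \<delta> p d \<subseteq> A" using Int.IH(1) p by blast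
      obtain e where e: "e > 0" "mobius_nbhd \<delta> p e \<subseteq> B" using Int.IH(2) p by blast
      have "mobius_nbhd \<delta> p (min d e) \<subseteq> A \<inter> B"
        using d(2) e(2) mobius_nbhd_mono[of "min d e" d \<delta> p] mobius_nbhd_mono[of "min d e" e \<delta> p]
        by (meson Int_greatest min.cobounded1 min.cobounded2 subset_trans)
      moreover have "0 < min d e" using d e by simp
      ultimately show "\<exists>\<epsilon>>0. mobius_nbhd \<delta> p \<epsilon> \<subseteq> A \<inter> B" by blast
    qed
  next
    case (UN K)
    show ?case
    proof (intro conjI ballI)
      show "\<Union> K \<subseteq> mobius_carrier \<delta>" using UN.IH by (intro Union_least) simp
    next
      fix p assume "p \<in> \<Union> K"
      then obtain k where k: "k \<in> K" "p \<in> k" by blast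
      then obtain e where "e > 0" "mobius_nbhd \<delta> p e \<subseteq> k" using UN.IH[of k] by blast
      moreover have "k \<subseteq> \<Union> K" using k by blast
      ultimately show "\<exists>\<epsilon>>0. mobius_nbhd \<delta> p \<epsilon> \<subseteq> \<Union> K" by (meson subset_trans)
    qed
  next
    case (Basis S)
    then obtain p e where S: "S = mobius_nbhd \<delta> p e" and p: "p \<in> mobius_carrier \<delta>"
      by blast
    show ?case unfolding S using mobius_nbhd_refine[OF p] mobius_nbhd_subset by simp
  qed
next
  assume R: "?R U"
  show "openin (mobius_topology \<delta>) U"
  proof (rule iffD2[OF openin_subopen], intro ballI)
    fix p assume "p \<in> U"
    with R obtain e where e: "e > 0" "mobius_nbhd \<delta> p e \<subseteq> U" by blast
    have p: "p \<in> mobius_carrier \<delta>" using R \<open>p \<in> U\<close> by blast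
    have "openin (mobius_topology \<delta>) (mobius_nbhd \<delta> p e)"
      unfolding mobius_topology_def using e(1) p by (intro topology_generated_by_Basis) blast
    then show "\<exists>T. openin (mobius_topology \<delta>) T \<and> p \<in> T \<and> T \<subseteq> U"
      using e mobius_nbhd_self[OF p] by blast
  qed
qed

end

theory Submission
  imports Defs
begin

text \<open>If \<open>\<delta> \<ge> 2\<close>, injectivity fails: \<open>(0, -2)\<close> and \<open>(\<pi>, 0)\<close> have the same image.
  If \<open>\<delta> < 2\<close>, compare two points with the same image through their signed distance
  \<open>1 + r cos (t/2)\<close> to the vertical axis. Equal nonzero distances force equal angles, two zero
  distances force \<open>r (cos (t/2), sin (t/2))\<close> to agree, and opposite nonzero distances force the angles
  to differ by \<open>\<pi>\<close>, which needs \<open>\<bar>r\<bar> \<ge> 2\<close> for one of the points. The strip is compact, being a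
  continuous image of a closed rectangle, so the continuous injection is a homeomorphism onto its
  image.\<close>

section \<open>Continuity of the parametrization in the strip topology\<close>

lemma mobius_map_eq_iff:
  "mobius_map (t, r) = mobius_map (t', r') \<longleftrightarrow>
     (1 + r * cos (t / 2)) * cos t = (1 + r' * cos (t' / 2)) * cos t' \<and>
     (1 + r * cos (t / 2)) * sin t = (1 + r' * cos (t' / 2)) * sin t' \<and>
     r * sin (t / 2) = r' * sin (t' / 2)"
  by (simp add: mobius_map_def vec_eq_iff forall_3 algebra_simps)

text \<open>Passing to the twin shifts \<open>t / 2\<close> by \<pi>, so both half-angle functions
  change sign; the sign change of \<open>r\<close> cancels this.\<close>

lemma mobius_map_twin: "mobius_map (mobius_twin p) = mobius_map p"
proof -
  have "(fst p + 2 * pi) / 2 = fst p / 2 + pi" by (simp add: add_divide_distrib)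
  then show ?thesis
    by (cases p) (simp only: mobius_twin_def mobius_map_eq_iff fst_conv snd_conv, simp)
qed

lemma continuous_on_mobius_map: "continuous_on UNIV mobius_map"
proof -
  have "continuous_on UNIV (\<lambda>p. mobius_map p $ i)" for i
  proof -
    have *: "mobius_map p $ 1 = cos (fst p) + snd p * cos (fst p / 2) * cos (fst p)"
      "mobius_map p $ 2 = sin (fst p) + snd p * cos (fst p / 2) * sin (fst p)"
      "mobius_map p $ 3 = snd p * sin (fst p / 2)" for p
      by (simp_all add: mobius_map_def case_prod_beta)
    show ?thesis
      using exhaust_3[of i] by (elim disjE) (simp_all only: *, auto intro!: continuous_intros)
  qed
  then show ?thesis
    using continuous_on_vec_lambda[of UNIV "\<lambda>i p. mobius_map p $ i"] by simp
qed

text \<open>The Euclidean preimage of an open set is open and, by \<open>mobius_map_twin\<close>,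
  contains the twin of each of its points, so balls about both fit inside it.\<close>

lemma continuous_map_mobius_map:
  "continuous_map (mobius_topology \<delta>) (top_of_set (mobius_map ` mobius_carrier \<delta>)) mobius_map"
proof -
  have "openin (mobius_topology \<delta>) {p \<in> mobius_carrier \<delta>. mobius_map p \<in> U}" if "open U" for U
    unfolding openin_mobius_topology_iff
  proof (intro conjI ballI)
    fix p assume "p \<in> {p \<in> mobius_carrier \<delta>. mobius_map p \<in> U}"
    then have p: "p \<in> mobius_map -` U" "mobius_twin p \<in> mobius_map -` U"
      by (simp_all add: mobius_map_twin)
    have o: "open (mobius_map -` U)"
      using continuous_on_mobius_map that by (simp add: open_vimage)
    obtain d where d: "d > 0" "ball p d \<subseteq> mobius_map -` U"
      using o p(1) openE by blast
    obtain e where e: "e > 0" "ball (mobius_twin p) e \<subseteq> mobius_map -` U"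
      using o p(2) openE by blast
    have "ball p (min d e) \<union> ball (mobius_twin p) (min d e) \<subseteq> mobius_map -` U"
      using d(2) e(2) by auto
    then have "mobius_nbhd \<delta> p (min d e) \<subseteq> {p \<in> mobius_carrier \<delta>. mobius_map p \<in> U}"
      unfolding mobius_nbhd_def by blast
    then show "\<exists>\<epsilon>>0. mobius_nbhd \<delta> p \<epsilon> \<subseteq> {p \<in> mobius_carrier \<delta>. mobius_map p \<in> U}"
      using d(1) e(1) by (meson min_less_iff_conj)
  qed auto
  then have "continuous_map (mobius_topology \<delta>) euclidean mobius_map"
    by (simp add: continuous_map_def topspace_mobius_topology)
  then show ?thesis
    by (rule continuous_map_into_subtopology) (simp add: topspace_mobius_topology)
qed

section \<open>Compactness of the strip\<close>

text \<open>The map \<open>q\<close> glues the edge \<open>t = 2 * pi\<close> of the closed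
  rectangle \<open>S\<close> to the edge \<open>t = 0\<close> with a flip; it carries compactness
  over to the strip.\<close>

lemma compact_space_mobius_topology: "compact_space (mobius_topology \<delta>)"
proof -
  define S where "S = {0..2 * pi} \<times> {-\<delta>..\<delta>}"
  define q where "q = (\<lambda>(t::real, r::real). if t = 2 * pi then (0, - r) else (t, r))"
  have qS: "q x \<in> mobius_carrier \<delta>" if "x \<in> S" for x
    using that by (auto simp: S_def q_def mobius_carrier_def)
  have "openin (top_of_set S) {x \<in> S. q x \<in> U}" if U: "openin (mobius_topology \<delta>) U" for U
    unfolding openin_euclidean_subtopology_iff
  proof (intro conjI ballI)
    fix x assume "x \<in> {x \<in> S. q x \<in> U}"
    then have x: "x \<in> S" "q x \<in> U" by auto
    then obtain e where e: "e > 0" "mobius_nbhd \<delta> (q x) e \<subseteq> U"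
      using U unfolding openin_mobius_topology_iff by blast
    obtain t r where tr: "x = (t, r)" by fastforce
    \<comment> \<open>Off the glued edge, the bound \<open>2 * pi - t\<close> keeps nearby points
      away from that edge, so that \<open>q\<close> fixes them.\<close>
    define d where "d = (if t = 2 * pi then e else min e (2 * pi - t))"
    have d: "d > 0" using e x by (auto simp: d_def S_def tr)
    have "q y \<in> U" if y: "y \<in> S" "dist y x < d" for y
    proof -
      obtain s u where su: "y = (s, u)" by fastforce
      have "q y \<in> ball (q x) e \<union> ball (mobius_twin (q x)) e"
      proof (cases "t = 2 * pi")
        case True
        show ?thesis
        proof (cases "s = 2 * pi")
          case s: True
          have "dist (q x) (q y) = dist y x"
            using True s by (simp add: q_def tr su dist_Pair_Pair dist_real_def)
          then show ?thesis using y True by (simp add: d_def)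
        next
          case False
          \<comment> \<open>Here \<open>q\<close> moves \<open>x\<close> to the opposite edge but
            fixes the nearby \<open>y\<close>; the ball about the twin is what catches
            \<open>y\<close>.\<close>
          have "mobius_twin (q x) = x" "q y = y"
            using True False by (auto simp: mobius_twin_def q_def tr su)
          then show ?thesis using y True by (simp add: d_def dist_commute)
        qed
      next
        case False
        have "dist s t < 2 * pi - t"
          using dist_fst_le[of y x] y(2) False by (simp add: tr su d_def)
        then have "q y = y" "q x = x"
          using False by (auto simp: q_def tr su dist_real_def)
        then show ?thesis using y False by (simp add: d_def dist_commute)
      qed
      then show ?thesis using qS[OF y(1)] e(2) unfolding mobius_nbhd_def by blast
    qed
    then show "\<exists>e>0. \<forall>x'\<in>S. dist x' x < e \<longrightarrow> x' \<in> {x \<in> S. q x \<in> U}"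
      using d by blast
  qed auto
  then have "continuous_map (top_of_set S) (mobius_topology \<delta>) q"
    using qS by (auto simp: continuous_map_def topspace_mobius_topology)
  moreover have "compactin (top_of_set S) S"
    by (simp add: compactin_subtopology S_def compact_Times)
  ultimately have "compactin (mobius_topology \<delta>) (q ` S)" by (rule image_compactin[rotated])
  moreover have "q ` S = mobius_carrier \<delta>"
  proof
    show "mobius_carrier \<delta> \<subseteq> q ` S"
    proof
      fix p assume "p \<in> mobius_carrier \<delta>"
      then have "p \<in> S" "q p = p" by (auto simp: mobius_carrier_def S_def q_def)
      then show "p \<in> q ` S" by (metis imageI)
    qed
  qed (use qS in auto)
  ultimately show ?thesis by (simp add: compact_space_def topspace_mobius_topology)
qed

section \<open>Injectivity for \<delta> < 2\<close>

text \<open>For \<open>c\<close> and \<open>s\<close> the cosine and sine of \<open>t / 2\<close>,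
  the factor \<open>c\<^sup>2 - s\<^sup>2\<close> is \<open>cos t\<close>. It is nonnegative and at
  most \<open>\<bar>c\<bar>\<close>, so taking absolute values in the equation and cancelling
  \<open>\<bar>c\<bar>\<close> gives the bound.\<close>

lemma two_le_abs_offset:
  fixes c r s :: real
  assumes "2 * c + r * (c\<^sup>2 - s\<^sup>2) = 0" "c\<^sup>2 + s\<^sup>2 = 1" "s\<^sup>2 \<le> c\<^sup>2"
  shows "2 \<le> \<bar>r\<bar>"
proof -
  have c: "0 < c\<^sup>2" "c\<^sup>2 \<le> 1" using assms zero_le_power2[of s] by linarith+
  then have c1: "0 < \<bar>c\<bar>" "\<bar>c\<bar> \<le> 1" by (auto simp: abs_square_le_1)
  have "2 * \<bar>c\<bar> = \<bar>r\<bar> * (c\<^sup>2 - s\<^sup>2)"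
  proof -
    have "\<bar>2 * c\<bar> = \<bar>r * (c\<^sup>2 - s\<^sup>2)\<bar>" using assms(1) by linarith
    then show ?thesis using assms(3) by (simp add: abs_mult)
  qed
  also have "\<dots> \<le> \<bar>r\<bar> * \<bar>c\<bar>"
  proof (rule mult_left_mono)
    have "c\<^sup>2 - s\<^sup>2 \<le> \<bar>c\<bar> * \<bar>c\<bar>" by (simp add: power2_eq_square)
    also have "\<dots> \<le> \<bar>c\<bar>" using c1 by (intro mult_left_le) auto
    finally show "c\<^sup>2 - s\<^sup>2 \<le> \<bar>c\<bar>" .
  qed simp
  finally show ?thesis using c1 by simp
qed

lemma inj_on_mobius_map:
  assumes "\<delta> < 2"
  shows "inj_on mobius_map (mobius_carrier \<delta>)"
proof (rule inj_onI, clarify)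
  fix t r t' r'
  assume P: "(t, r) \<in> mobius_carrier \<delta>" "(t', r') \<in> mobius_carrier \<delta>"
    and eq: "mobius_map (t, r) = mobius_map (t', r')"
  define c s c' s' where cs: "c = cos (t / 2)" "s = sin (t / 2)" "c' = cos (t' / 2)" "s' = sin (t' / 2)"
  have rng: "0 \<le> t" "t < 2 * pi" "0 \<le> t'" "t' < 2 * pi" "\<bar>r\<bar> < 2" "\<bar>r'\<bar> < 2"
    using P assms by (auto simp: mobius_carrier_def)
  have one: "c\<^sup>2 + s\<^sup>2 = 1" "c'\<^sup>2 + s'\<^sup>2 = 1" by (simp_all add: cs)
  have e: "(1 + r * c) * cos t = (1 + r' * c') * cos t'"
    "(1 + r * c) * sin t = (1 + r' * c') * sin t'" "r * s = r' * s'"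
    using eq by (simp_all add: mobius_map_eq_iff cs)
  have half: "2 * ((t - t') / 2) = t - t'" by simp
  \<comment> \<open>Cosine is injective on [0, \<pi>), where the half-angles lie, and
    \<open>r\<close> is recovered from \<open>r * c\<close> and \<open>r * s\<close> as
    \<open>r * c * c + r * s * s\<close>.\<close>
  have *: "t = t' \<and> r = r'" if "c = c'" "s = s'" "r * c = r' * c'"
  proof
    have "cos (t / 2) = cos (t' / 2)" using that(1) unfolding cs .
    with rng have "t / 2 = t' / 2" by (auto dest: cos_inj_pi[rotated 4])
    then show "t = t'" by simp
    have expand: "x = x * c * c + x * s * s" for x
    proof -
      have "x * c * c + x * s * s = x * (c\<^sup>2 + s\<^sup>2)"
        by (simp add: power2_eq_square distrib_left)
      then show ?thesis using one(1) by simp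
    qed
    have "r = r * c * c + r * s * s" by (rule expand)
    also have "\<dots> = r' * c * c + r' * s * s"
      using that(3) e(3) unfolding that(1,2) by (simp only:)
    also have "\<dots> = r'" by (rule expand[symmetric])
    finally show "r = r'" .
  qed
  \<comment> \<open>Squaring and adding the two horizontal coordinates eliminates the angles and
    fixes the signed distance up to sign.\<close>
  have "(1 + r * c)\<^sup>2 = ((1 + r * c) * cos t)\<^sup>2 + ((1 + r * c) * sin t)\<^sup>2"
    by (simp add: power_mult_distrib flip: distrib_left)
  also have "\<dots> = (1 + r' * c')\<^sup>2"
    unfolding e(1,2) by (simp add: power_mult_distrib flip: distrib_left)
  finally have "1 + r * c = 1 + r' * c' \<or> 1 + r * c = - (1 + r' * c')"
    by (simp only: power2_eq_iff)
  then consider "1 + r * c = 0" "1 + r' * c' = 0" | "1 + r * c = 1 + r' * c'" "1 + r * c \<noteq> 0"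
    | "1 + r * c = - (1 + r' * c')" "1 + r * c \<noteq> 0"
    by (metis neg_equal_0_iff_equal)
  then show "t = t' \<and> r = r'"
  proof cases
    case 1
    have s: "0 \<le> s" "0 \<le> s'" using rng by (auto simp: cs intro!: sin_ge_zero)
    have "r\<^sup>2 = (r * c)\<^sup>2 + (r * s)\<^sup>2"
      using one by (simp add: power_mult_distrib flip: distrib_left)
    also have "\<dots> = (r' * c')\<^sup>2 + (r' * s')\<^sup>2"
    proof -
      have "r * c = r' * c'" using 1 by linarith
      then show ?thesis using e(3) by simp
    qed
    also have "\<dots> = r'\<^sup>2"
      using one by (simp add: power_mult_distrib flip: distrib_left)
    finally have "r = r' \<or> r = - r'" by (simp add: power2_eq_iff)
    moreover have "r \<noteq> 0" "r' \<noteq> 0" using 1 by auto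
    \<comment> \<open>Opposite offsets with equal heights force both nonnegative sines to vanish.
      Then both angles are 0, and zero distance makes both offsets -1.\<close>
    moreover have "r = r'" if "r = - r'"
    proof -
      have "r' * (s + s') = 0" using that e(3) by (simp add: distrib_left)
      then have "s + s' = 0" using \<open>r' \<noteq> 0\<close> by simp
      then have "s = 0" "s' = 0" using s by linarith+
      then have "t = 0" "t' = 0"
        using rng sin_gt_zero[of "t / 2"] sin_gt_zero[of "t' / 2"] by (force simp: cs)+
      then show ?thesis using 1 by (simp add: cs)
    qed
    ultimately have "r = r'" by blast
    moreover have "r * c = r' * c'" using 1 by linarith
    ultimately show ?thesis using e(3) \<open>r \<noteq> 0\<close> by (intro *) auto
  next
    case 2
    then have "cos t = cos t'" "sin t = sin t'" using e by auto
    then have "cos (t - t') = 1" by (simp add: cos_diff flip: power2_eq_square)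
    moreover have "cos (t - t') = 1 - 2 * (sin ((t - t') / 2))\<^sup>2"
      using cos_double_sin[of "(t - t') / 2"] unfolding half .
    ultimately have "sin ((t - t') / 2) = 0" by simp
    \<comment> \<open>The half-difference lies in (-\<pi>, \<pi>), where 0 is the only zero of
      sine.\<close>
    then have "t = t'" using rng sin_eq_0_pi[of "(t - t') / 2"] by simp
    with 2 show ?thesis by (intro *) (auto simp: cs)
  next
    case 3
    then have "1 + r' * c' = - (1 + r * c)" by linarith
    then have "(1 + r * c) * (cos t + cos t') = 0" "(1 + r * c) * (sin t + sin t') = 0"
      using e(1,2) by (simp_all only: distrib_left mult_minus_left)
    then have op: "cos t' = - cos t" "sin t' = - sin t"
      using 3(2) by (simp_all add: add_eq_0_iff)
    have "cos (t - t') = - 1"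
      using op sin_cos_squared_add[of t] by (simp add: cos_diff power2_eq_square)
    moreover have "cos (t - t') = 2 * (cos ((t - t') / 2))\<^sup>2 - 1"
      using cos_double_cos[of "(t - t') / 2"] unfolding half .
    ultimately have "cos ((t - t') / 2) = 0" by simp
    \<comment> \<open>Angles differing by \<pi> modulo 2 \<pi> have orthogonal half-angle
      vectors.\<close>
    then have orth: "c * c' + s * s' = 0" by (simp add: cs diff_divide_distrib cos_diff)
    have sum: "2 + r * c + r' * c' = 0" using 3(1) by linarith
    \<comment> \<open>The coefficients are chosen to eliminate the other point from three vanishing
      quantities: the sum of the distances, the inner product and the height difference.\<close>
    have "2 * c + r * (c\<^sup>2 - s\<^sup>2)
        = c * (2 + r * c + r' * c') - r' * (c * c' + s * s') - s * (r * s - r' * s')"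
      by (simp add: algebra_simps power2_eq_square)
    then have "2 * c + r * (c\<^sup>2 - s\<^sup>2) = 0" using orth sum e(3) by simp
    moreover have "2 * c' + r' * (c'\<^sup>2 - s'\<^sup>2)
        = c' * (2 + r * c + r' * c') - r * (c * c' + s * s') + s' * (r * s - r' * s')"
      by (simp add: algebra_simps power2_eq_square)
    then have "2 * c' + r' * (c'\<^sup>2 - s'\<^sup>2) = 0" using orth sum e(3) by simp
    \<comment> \<open>The cosines of the two angles are opposite, so one of them is nonnegative;
      \<open>two_le_abs_offset\<close> applies to that point.\<close>
    moreover have "s\<^sup>2 \<le> c\<^sup>2 \<or> s'\<^sup>2 \<le> c'\<^sup>2"
    proof -
      have "c * c' = - (s * s')" using orth by simp
      then have "c\<^sup>2 * c'\<^sup>2 = s\<^sup>2 * s'\<^sup>2" by (metis power2_minus power_mult_distrib)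
      moreover have "s\<^sup>2 = 1 - c\<^sup>2" "s'\<^sup>2 = 1 - c'\<^sup>2" using one by simp_all
      ultimately have "c\<^sup>2 - s\<^sup>2 = - (c'\<^sup>2 - s'\<^sup>2)" by (simp add: algebra_simps)
      then show ?thesis by linarith
    qed
    ultimately show ?thesis using two_le_abs_offset one rng by (meson not_le)
  qed
qed

section \<open>Failure of injectivity for \<delta> \<ge> 2\<close>

lemma not_inj_on_mobius_map:
  assumes "2 \<le> \<delta>"
  shows "\<not> inj_on mobius_map (mobius_carrier \<delta>)"
proof
  assume "inj_on mobius_map (mobius_carrier \<delta>)"
  \<comment> \<open>The common image is (-1, 0, 0): the segment at angle 0 crosses the axis at
    offset -1 and meets the central circle again at offset -2.\<close>
  moreover have "mobius_map (0, -2) = mobius_map (pi, 0)" by (simp add: mobius_map_eq_iff)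
  moreover have "(0, -2) \<in> mobius_carrier \<delta>" "(pi, 0) \<in> mobius_carrier \<delta>"
    using assms by (auto simp: mobius_carrier_def)
  ultimately have "(0::real, -2::real) = (pi, 0)" by (rule inj_onD)
  then show False by simp
qed

theorem theorem1p9:
  fixes \<delta> :: real
  assumes "\<delta> > 0"
  shows "homeomorphic_map (mobius_topology \<delta>)
           (top_of_set (mobius_map ` mobius_carrier \<delta>)) mobius_map
         \<longleftrightarrow> \<delta> < 2"
proof
  assume "homeomorphic_map (mobius_topology \<delta>)
           (top_of_set (mobius_map ` mobius_carrier \<delta>)) mobius_map"
  then have "inj_on mobius_map (mobius_carrier \<delta>)"
    by (simp add: homeomorphic_eq_everything_map topspace_mobius_topology)
  then show "\<delta> < 2" using not_inj_on_mobius_map[of \<delta>] by linarith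
next
  assume "\<delta> < 2"
  show "homeomorphic_map (mobius_topology \<delta>)
           (top_of_set (mobius_map ` mobius_carrier \<delta>)) mobius_map"
  proof (rule bijective_closed_imp_homeomorphic_map)
    \<comment> \<open>Closedness, from a compact source and a Hausdorff target, replaces a direct
      proof that the inverse is continuous.\<close>
    show "closed_map (mobius_topology \<delta>) (top_of_set (mobius_map ` mobius_carrier \<delta>)) mobius_map"
      by (intro continuous_imp_closed_map compact_space_mobius_topology continuous_map_mobius_map
          Hausdorff_space_subtopology Hausdorff_space_euclidean)
  qed (simp_all add: continuous_map_mobius_map topspace_mobius_topology inj_on_mobius_map \<open>\<delta> < 2\<close>)
qed

end
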